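(* Let $\ell\in\mathbb{N}$. Suppose $\mathfrak{g}\in H^{\ell}$ satisfies (A1) $\operatorname{div}^{k}\mathfrak{g}_{n}>0$ for all $n\geq\ell-k$ and $0\leq k<\ell$, and (A2) $(-\Delta)^{\ell-k}\operatorname{div}^{k}\mathfrak{g}_{n}\geq0$ for all $n\geq\ell+1-k$ and $1\leq k<\ell$. Then for all $u\in\mathcal{H}_{0}^{\ell}$ we have the inequality $$\sum_{n=\lceil\ell/2\rceil}^{\infty}\left|(-\Delta)^{\ell/2}u_{n}\right|^{2}\geq\sum_{n=\ell}^{\infty}\rho_{n}(\mathfrak{g})|u_{n}|^{2},$$ where $\rho_n(\mathfrak{g}):=(-\Delta)^{\ell}\mathfrak{g}_n/\mathfrak{g}_n$ for $n\geq\ell$. If in addition (A2') $(-\Delta)^{\ell}\mathfrak{g}_{n}\geq0$ for all $n\geq\ell$, then $\rho(\mathfrak{g})\geq0$, i.e. $\rho(\mathfrak{g})=\{\rho_n(\mathfrak{g})\}_{n=\ell}^{\infty}$ is a discrete Hardy--Rellich--Birman weight.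
   Context: $\mathbb{N}=\{1,2,\dots\}$. All sequences are complex sequences indexed by $\mathbb{Z}$. Difference operators on such sequences: $(\nabla u)_{n}:=u_{n}-u_{n-1}$, $(\operatorname{div}u)_{n}:=u_{n+1}-u_{n}$, $(\Delta u)_{n}:=u_{n-1}-2u_{n}+u_{n+1}$. We write $\operatorname{div}^{k}u_{n}$ for $(\operatorname{div}^{k}u)_{n}$, $(-\Delta)^{j}u_n$ for $((-\Delta)^{j}u)_n$, etc.; compositions are written by juxtaposition, and the zeroth power of an operator is the identity. Half-integer powers: $(-\Delta)^{\ell/2}:=(-\Delta)^{m}$ if $\ell=2m$, and $(-\Delta)^{\ell/2}:=\nabla(-\Delta)^{m}$ if $\ell=2m+1$. $\lceil x\rceil$ is the least integer $\geq x$. Spaces: $H^{\ell}:=\{u:\mathbb{Z}\to\mathbb{C}\mid u_{n}=0\text{ for all }n<\ell\}$, and $\mathcal{H}_{0}^{\ell}:=\{u\in H^{\ell}\mid u\text{ has finite support}\}$. A nonnegative sequence $\{\rho_{n}\}_{n=\ell}^{\infty}$ is a discrete Hardy--Rellich--Birman weight (for the given $\ell$; Hardy for $\ell=1$, Rellich for $\ell=2$, Birman for $\ell\ge3$) if $\sum_{n=\lceil\ell/2\rceil}^{\infty}|(-\Delta)^{\ell/2}u_{n}|^{2}\geq\sum_{n=\ell}^{\infty}\rho_{n}|u_{n}|^{2}$ for all $u\in\mathcal{H}_{0}^{\ell}$. *)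

theory Defs
  imports "HOL-Analysis.Analysis" "HOL-Library.Complex_Order"
begin

text \<open>
  Sequences are functions of type \<open>int \<Rightarrow> complex\<close>.  Order relations between complex numbers
  are those of \<open>HOL-Library.Complex_Order\<close>: \<open>x \<le> y\<close> means \<open>Re x \<le> Re y\<close> and \<open>Im x = Im y\<close>.
  Thus \<open>0 < z\<close> (or \<open>0 \<le> z\<close>) says that \<open>z\<close> is real and positive (or nonnegative).
\<close>

definition nabla :: "(int \<Rightarrow> complex) \<Rightarrow> int \<Rightarrow> complex" where
  "nabla u n = u n - u (n - 1)"

definition div_op :: "(int \<Rightarrow> complex) \<Rightarrow> int \<Rightarrow> complex" where
  "div_op u n = u (n + 1) - u n"

definition laplacian :: "(int \<Rightarrow> complex) \<Rightarrow> int \<Rightarrow> complex" where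
  "laplacian u n = u (n - 1) - 2 * u n + u (n + 1)"

definition neg_laplacian :: "(int \<Rightarrow> complex) \<Rightarrow> int \<Rightarrow> complex" where
  "neg_laplacian u n = - laplacian u n"

definition neg_laplacian_half_power :: "nat \<Rightarrow> (int \<Rightarrow> complex) \<Rightarrow> int \<Rightarrow> complex" where
  "neg_laplacian_half_power l u =
     (if even l then (neg_laplacian ^^ (l div 2)) u
      else nabla ((neg_laplacian ^^ (l div 2)) u))"

definition H_space :: "nat \<Rightarrow> (int \<Rightarrow> complex) set" where
  "H_space l = {u. \<forall>n < int l. u n = 0}"

definition H0_space :: "nat \<Rightarrow> (int \<Rightarrow> complex) set" where
  "H0_space l = {u \<in> H_space l. finite {n. u n \<noteq> 0}}"

text \<open>
  For \<open>u \<in> H0_space l\<close> only finitely many terms of either sum are nonzero, so both sums converge.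
  Only the values \<open>\<rho> n\<close> with \<open>n \<ge> l\<close> are relevant.  The sum on the right is complex because
  \<open>\<rho>\<close> is; the inequality includes the assertion that it is real.
\<close>

definition HRB_inequality :: "nat \<Rightarrow> (int \<Rightarrow> complex) \<Rightarrow> (int \<Rightarrow> complex) \<Rightarrow> bool" where
  "HRB_inequality l \<rho> u \<longleftrightarrow>
     complex_of_real (\<Sum>\<^sub>\<infinity>n\<in>{\<lceil>real l / 2\<rceil>..}. (cmod (neg_laplacian_half_power l u n))\<^sup>2)
       \<ge> (\<Sum>\<^sub>\<infinity>n\<in>{int l..}. \<rho> n * complex_of_real ((cmod (u n))\<^sup>2))"

definition HRB_weight :: "nat \<Rightarrow> (int \<Rightarrow> complex) \<Rightarrow> bool" where
  "HRB_weight l \<rho> \<longleftrightarrow>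
     (\<forall>n \<ge> int l. \<rho> n \<ge> 0) \<and> (\<forall>u \<in> H0_space l. HRB_inequality l \<rho> u)"

definition rho :: "nat \<Rightarrow> (int \<Rightarrow> complex) \<Rightarrow> int \<Rightarrow> complex" where
  "rho l g n = (neg_laplacian ^^ l) g n / g n"

end

theory Submission
  imports Defs
begin

text \<open>
  The inequality is a chain of \<open>l\<close> weighted Hardy inequalities, one for each derivative.  Write
  \<open>g\<^sub>k = div\<^sup>k g\<close> and \<open>u\<^sub>k = div\<^sup>k u\<close>, and for \<open>k < l\<close> let \<open>W\<^sub>k = (-\<Delta>)\<^bsup>l-k\<^esup> g\<^sub>k / g\<^sub>k\<close>, with
  \<open>W\<^sub>l = 1\<close>.  The claim is that the energies \<open>Q\<^sub>k = \<Sum>\<^sub>n W\<^sub>k(n) |u\<^sub>k(n)|\<^sup>2\<close> do not decrease as \<open>k\<close> grows.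

  The step from \<open>k\<close> to \<open>k + 1\<close> is the ground state substitution.  If \<open>h > 0\<close>, then
  \<open>|v(n+1) - v(n)|\<^sup>2 - (h(n+1) - h(n)) (|v(n+1)|\<^sup>2 / h(n+1) - |v(n)|\<^sup>2 / h(n))\<close> equals
  \<open>h(n) h(n+1) |v(n+1)/h(n+1) - v(n)/h(n)|\<^sup>2 \<ge> 0\<close>.  Multiplying by a weight \<open>w \<ge> 0\<close> and summing by
  parts bounds \<open>\<Sum> w |div v|\<^sup>2\<close> from below by \<open>\<Sum> (-\<nabla>(w div h) / h) |v|\<^sup>2\<close>
  (\<open>weighted_hardy_inequality\<close>).  For \<open>h = g\<^sub>k\<close>, \<open>v = u\<^sub>k\<close> and \<open>w = W\<^sub>k\<^sub>+\<^sub>1\<close> the product \<open>w div h\<close> is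
  \<open>(-\<Delta>)\<^bsup>l-k-1\<^esup> div g\<^sub>k\<close>, and since \<open>-\<nabla> div = -\<Delta>\<close>, the new weight is exactly \<open>W\<^sub>k\<close>
  (\<open>neg_laplacian_power_Suc_eq\<close>).  The positivity hypothesis (A1) makes the substitution possible,
  and (A2) makes the intermediate weights nonnegative.  On the support of \<open>g\<^sub>k\<^sub>+\<^sub>1\<close>, (A2) is silent
  only about the first index \<open>n = l - k - 1\<close>; there \<open>h\<close> and \<open>v\<close> vanish and the pointwise estimate
  degenerates to an equality, so the sign of the weight does not matter.

  It remains to compare the ends of the chain: \<open>Q\<^sub>0\<close> is the right-hand side of the inequality, and
  \<open>Q\<^sub>l = \<Sum> |div\<^sup>l u|\<^sup>2\<close> is the left-hand side, because \<open>(-\<Delta>)\<^bsup>l/2\<^esup>\<close> is \<open>div\<^sup>l\<close> up to a sign and a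
  translation by \<open>\<lceil>l/2\<rceil>\<close> (\<open>cmod_neg_laplacian_half_power\<close>).
\<close>

section \<open>Powers of the difference operators\<close>

lemma neg_laplacian_eq: "neg_laplacian f n = div_op f (n - 1) - div_op f n"
  by (simp add: neg_laplacian_def laplacian_def div_op_def)

text \<open>
  Since \<open>-\<Delta> = -\<nabla> div\<close> and translation-invariant operators commute, one \<open>-\<nabla>\<close> can be moved to the
  far left and one \<open>div\<close> to the far right of a power of \<open>-\<Delta>\<close>.
\<close>

lemma neg_laplacian_power_Suc_eq:
  "(neg_laplacian ^^ Suc j) f n =
     (neg_laplacian ^^ j) (div_op f) (n - 1) - (neg_laplacian ^^ j) (div_op f) n"
proof (induction j arbitrary: n)
  case 0
  show ?case by (simp add: neg_laplacian_eq)
next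
  case (Suc j)
  have "(neg_laplacian ^^ Suc (Suc j)) f n = neg_laplacian ((neg_laplacian ^^ Suc j) f) n"
    by simp
  also have "\<dots> = (neg_laplacian ^^ Suc j) (div_op f) (n - 1) - (neg_laplacian ^^ Suc j) (div_op f) n"
    unfolding neg_laplacian_eq[of "(neg_laplacian ^^ Suc j) f" n] div_op_def[of "(neg_laplacian ^^ Suc j) f"]
      Suc.IH
    using neg_laplacian_eq[of "(neg_laplacian ^^ j) (div_op f)" n]
      neg_laplacian_eq[of "(neg_laplacian ^^ j) (div_op f)" "n - 1"]
    by (simp add: div_op_def[of "(neg_laplacian ^^ j) (div_op f)"])
  finally show ?case .
qed

lemma neg_laplacian_power_real:
  assumes "\<And>n. f n \<in> \<real>"
  shows "(neg_laplacian ^^ k) f n \<in> \<real>"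
proof (induction k arbitrary: n)
  case 0
  show ?case using assms by simp
next
  case (Suc k)
  then show ?case by (simp add: neg_laplacian_def laplacian_def)
qed

lemma div_op_power_vanishes:
  assumes "\<And>n. n < a \<Longrightarrow> f n = 0" and "n < a - int k"
  shows "(div_op ^^ k) f n = 0"
  using assms(2)
proof (induction k arbitrary: n)
  case 0
  then show ?case using assms(1) by simp
next
  case (Suc k)
  then show ?case by (simp add: div_op_def)
qed

lemma finite_support_div_op_power:
  assumes "finite {n. f n \<noteq> 0}"
  shows "finite {n. (div_op ^^ k) f n \<noteq> 0}"
proof (induction k)
  case 0
  show ?case using assms by simp
next
  case (Suc k)
  let ?S = "{n. (div_op ^^ k) f n \<noteq> 0}"
  have "{n. (div_op ^^ Suc k) f n \<noteq> 0} \<subseteq> ?S \<union> (\<lambda>n. n - 1) ` ?S"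
  proof
    fix n assume "n \<in> {n. (div_op ^^ Suc k) f n \<noteq> 0}"
    then have "n \<in> ?S \<or> n + 1 \<in> ?S" by (auto simp: div_op_def)
    moreover have "n = (n + 1) - 1" by simp
    ultimately show "n \<in> ?S \<union> (\<lambda>n. n - 1) ` ?S" by blast
  qed
  then show ?case using Suc by (meson finite_UnI finite_imageI finite_subset)
qed

lemma neg_laplacian_power_eq_div_op_power:
  "(neg_laplacian ^^ m) u n = (- 1) ^ m * (div_op ^^ (2 * m)) u (n - int m)"
proof (induction m arbitrary: n)
  case 0
  show ?case by simp
next
  case (Suc m)
  \<comment> \<open>\<open>-\<Delta>\<close> is minus the second forward difference, taken one index earlier\<close>
  define d where "d = (div_op ^^ (2 * m)) u"
  have IH: "(neg_laplacian ^^ m) u j = (- 1) ^ m * d (j - int m)" for j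
    by (simp add: Suc d_def)
  have "(neg_laplacian ^^ Suc m) u n = neg_laplacian ((neg_laplacian ^^ m) u) n"
    by simp
  also have "\<dots> = (- 1) ^ m * - (d (n - int m - 1) - 2 * d (n - int m) + d (n - int m + 1))"
    unfolding neg_laplacian_def[of "(neg_laplacian ^^ m) u"] laplacian_def[of "(neg_laplacian ^^ m) u"] IH
    by (simp add: algebra_simps)
  also have "\<dots> = (- 1) ^ Suc m * div_op (div_op d) (n - int (Suc m))"
    by (simp add: div_op_def algebra_simps)
  also have "div_op (div_op d) = (div_op ^^ (2 * Suc m)) u"
    by (simp add: d_def)
  finally show ?case .
qed

lemma cmod_neg_laplacian_half_power:
  "cmod (neg_laplacian_half_power l u n) = cmod ((div_op ^^ l) u (n - \<lceil>real l / 2\<rceil>))"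
proof (cases "even l")
  case True
  then obtain m where "l = 2 * m" by (elim evenE)
  then show ?thesis
    by (simp add: neg_laplacian_half_power_def neg_laplacian_power_eq_div_op_power norm_mult norm_power)
next
  case False
  then obtain m where m: "l = 2 * m + 1" by (elim oddE)
  have c: "\<lceil>real l / 2\<rceil> = int m + 1"
    unfolding m by (simp add: ceiling_eq_iff)
  have "neg_laplacian_half_power l u n = (- 1) ^ m * (div_op ^^ l) u (n - (int m + 1))"
    by (simp add: m neg_laplacian_half_power_def neg_laplacian_power_eq_div_op_power nabla_def
        div_op_def algebra_simps)
  then show ?thesis by (simp add: c norm_mult norm_power)
qed

section \<open>The weighted Hardy inequality\<close>

lemma has_sum_difference:
  fixes f g :: "'a \<Rightarrow> real"
  assumes "(f has_sum x) A" and "(g has_sum y) A"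
  shows "((\<lambda>n. f n - g n) has_sum x - y) A"
  using has_sum_add[of f A x "\<lambda>n. - g n" "- y"] assms by (simp add: has_sum_uminus)

lemma infsum_translate:
  fixes f :: "int \<Rightarrow> real"
  shows "(\<Sum>\<^sub>\<infinity>n. f (n + c)) = (\<Sum>\<^sub>\<infinity>n. f n)"
  by (rule infsum_reindex_bij_betw) (rule bij_plus_right)

text \<open>
  The right-hand side minus the left-hand side is \<open>|a y - b x|\<^sup>2 / (a b)\<close>.  In the application \<open>a\<close>
  and \<open>b\<close> are neighbouring values of a positive sequence \<open>h\<close>.
\<close>

lemma ground_state_inequality:
  fixes a b :: real and x y :: complex
  assumes "a > 0" "b > 0"
  shows "(b - a) * ((cmod y)\<^sup>2 / b - (cmod x)\<^sup>2 / a) \<le> (cmod (y - x))\<^sup>2"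
proof -
  have eq: "(b - a) * ((p\<^sup>2 + q\<^sup>2) / b - (r\<^sup>2 + s\<^sup>2) / a) + ((a * p - b * r)\<^sup>2 + (a * q - b * s)\<^sup>2) / (a * b)
      = (p - r)\<^sup>2 + (q - s)\<^sup>2" for p q r s :: real
    using assms by (simp add: divide_simps) (simp add: algebra_simps power2_eq_square)
  have "0 \<le> ((a * p - b * r)\<^sup>2 + (a * q - b * s)\<^sup>2) / (a * b)" for p q r s :: real
    using assms by simp
  then have "(b - a) * ((p\<^sup>2 + q\<^sup>2) / b - (r\<^sup>2 + s\<^sup>2) / a) \<le> (p - r)\<^sup>2 + (q - s)\<^sup>2" for p q r s :: real
    using eq[of p q r s] by (smt (verit))
  then show ?thesis by (simp add: cmod_power2)
qed

text \<open>
  Summation by parts turns the sum of the pointwise estimates into this inequality.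
  Here \<open>P\<close> plays the part of \<open>w div h\<close>, and \<open>P (n - 1) - P n\<close> is \<open>-\<nabla> P\<close>.  Its values below
  \<open>a - 1\<close> are only ever multiplied by zero.  At \<open>n = a - 1\<close> both \<open>v n\<close> and \<open>h n\<close> vanish and the
  pointwise estimate is an equality, which is why \<open>w\<close> may have any sign there.
\<close>

lemma weighted_hardy_inequality:
  fixes h w P :: "int \<Rightarrow> real" and v :: "int \<Rightarrow> complex"
  assumes fin: "finite {n. v n \<noteq> 0}"
    and v0: "\<And>n. n < a \<Longrightarrow> v n = 0"
    and h0: "\<And>n. n < a \<Longrightarrow> h n = 0"
    and h_pos: "\<And>n. n \<ge> a \<Longrightarrow> h n > 0"
    and w: "\<And>n. n \<ge> a \<Longrightarrow> w n \<ge> 0"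
    and P: "\<And>n. n \<ge> a - 1 \<Longrightarrow> P n = w n * (h (n + 1) - h n)"
  shows "(\<Sum>\<^sub>\<infinity>n. (P (n - 1) - P n) / h n * (cmod (v n))\<^sup>2)
           \<le> (\<Sum>\<^sub>\<infinity>n. w n * (cmod (div_op v n))\<^sup>2)"
proof -
  define q where "q n = (cmod (v n))\<^sup>2 / h n" for n
  have fin_div: "finite {n. div_op v n \<noteq> 0}"
    using finite_support_div_op_power[OF fin, of 1] by simp
  have fin_shift: "finite {n. v (n + 1) \<noteq> 0}"
    by (rule finite_subset[OF _ finite_imageI[OF fin, of "\<lambda>n. n - 1"]]) (force simp: image_iff)
  have sum_shifted: "(\<lambda>n. P n * q (n + 1)) summable_on UNIV"
    by (rule finite_nonzero_values_imp_summable_on, rule finite_subset[OF _ fin_shift])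
      (auto simp: q_def)
  have sum_plain: "(\<lambda>n. P n * q n) summable_on UNIV" "(\<lambda>n. P (n - 1) * q n) summable_on UNIV"
    by (rule finite_nonzero_values_imp_summable_on, rule finite_subset[OF _ fin], auto simp: q_def)+
  have sum_div: "(\<lambda>n. w n * (cmod (div_op v n))\<^sup>2) summable_on UNIV"
    by (rule finite_nonzero_values_imp_summable_on, rule finite_subset[OF _ fin_div]) auto
  have pointwise: "P n * q (n + 1) - P n * q n \<le> w n * (cmod (div_op v n))\<^sup>2" for n
  proof -
    consider "n < a - 1" | "n = a - 1" | "n \<ge> a" by linarith
    then show ?thesis
    proof cases
      case 1
      then show ?thesis using v0 by (simp add: q_def div_op_def)
    next
      case 2
      then show ?thesis using v0[of n] h0[of n] h_pos[of a] P[of n] by (simp add: q_def div_op_def)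
    next
      case 3
      have "P n * q (n + 1) - P n * q n = w n * ((h (n + 1) - h n) * (q (n + 1) - q n))"
        using P[of n] 3 by (simp flip: right_diff_distrib)
      also have "\<dots> \<le> w n * (cmod (div_op v n))\<^sup>2"
        unfolding q_def div_op_def using 3 by (intro mult_left_mono ground_state_inequality h_pos w) auto
      finally show ?thesis .
    qed
  qed
  have "(\<Sum>\<^sub>\<infinity>n. (P (n - 1) - P n) / h n * (cmod (v n))\<^sup>2) = (\<Sum>\<^sub>\<infinity>n. P (n - 1) * q n - P n * q n)"
    by (rule infsum_cong) (simp add: q_def diff_divide_distrib algebra_simps)
  also have "\<dots> = (\<Sum>\<^sub>\<infinity>n. P (n - 1) * q n) - (\<Sum>\<^sub>\<infinity>n. P n * q n)"
    using sum_plain by (intro infsumI has_sum_difference has_sum_infsum)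
  also have "(\<Sum>\<^sub>\<infinity>n. P (n - 1) * q n) = (\<Sum>\<^sub>\<infinity>n. P n * q (n + 1))"
    using infsum_translate[of "\<lambda>n. P (n - 1) * q n" 1] by simp
  also have "\<dots> - (\<Sum>\<^sub>\<infinity>n. P n * q n) = (\<Sum>\<^sub>\<infinity>n. P n * q (n + 1) - P n * q n)"
    using sum_plain sum_shifted by (intro infsumI[symmetric] has_sum_difference has_sum_infsum)
  also have "\<dots> \<le> (\<Sum>\<^sub>\<infinity>n. w n * (cmod (div_op v n))\<^sup>2)"
    using sum_plain sum_shifted sum_div pointwise
    by (intro infsum_mono has_sum_imp_summable[OF has_sum_difference[OF has_sum_infsum has_sum_infsum]])
  finally show ?thesis .
qed

section \<open>The chain of energies\<close>

text \<open>
  Passing to real parts loses nothing where the weights matter: there (A1) makes the denominator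
  real, and the numerator is real because \<open>g\<close> is.
  The convention for \<open>k = l\<close> is needed because (A1) does not make \<open>div\<^sup>l g\<close> nonzero, so the quotient
  \<open>div\<^sup>l g / div\<^sup>l g\<close> need not be \<open>1\<close>.
\<close>

definition chain_weight :: "nat \<Rightarrow> (int \<Rightarrow> complex) \<Rightarrow> nat \<Rightarrow> int \<Rightarrow> real" where
  "chain_weight l g k n =
     (if k = l then 1
      else Re ((neg_laplacian ^^ (l - k)) ((div_op ^^ k) g) n) / Re ((div_op ^^ k) g n))"

definition chain_energy :: "nat \<Rightarrow> (int \<Rightarrow> complex) \<Rightarrow> (int \<Rightarrow> complex) \<Rightarrow> nat \<Rightarrow> real" where
  "chain_energy l g u k = (\<Sum>\<^sub>\<infinity>n. chain_weight l g k n * (cmod ((div_op ^^ k) u n))\<^sup>2)"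

lemma chain_energy_mono_step:
  assumes g: "g \<in> H_space l"
    and A1: "\<And>(k::nat) (n::int). k < l \<Longrightarrow> n \<ge> int l - int k \<Longrightarrow> (div_op ^^ k) g n > 0"
    and A2: "\<And>(k::nat) (n::int). 1 \<le> k \<Longrightarrow> k < l \<Longrightarrow> n \<ge> int l + 1 - int k \<Longrightarrow>
               (neg_laplacian ^^ (l - k)) ((div_op ^^ k) g) n \<ge> 0"
    and u: "u \<in> H0_space l"
    and k: "k < l"
  shows "chain_energy l g u k \<le> chain_energy l g u (Suc k)"
proof -
  define h where "h n = Re ((div_op ^^ k) g n)" for n
  define v where "v = (div_op ^^ k) u"
  define P where "P n = Re ((neg_laplacian ^^ (l - Suc k)) ((div_op ^^ Suc k) g) n)" for n
  define w where "w = chain_weight l g (Suc k)"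
  have h_Suc: "h (n + 1) - h n = Re ((div_op ^^ Suc k) g n)" for n
    by (simp add: h_def div_op_def)
  have weight: "chain_weight l g k n = (P (n - 1) - P n) / h n" for n
  proof -
    have "l - k = Suc (l - Suc k)" using k by simp
    then show ?thesis
      using k by (simp add: chain_weight_def P_def h_def neg_laplacian_power_Suc_eq del: funpow.simps(2))
        (simp add: funpow.simps(2))
  qed
  have "(\<Sum>\<^sub>\<infinity>n. (P (n - 1) - P n) / h n * (cmod (v n))\<^sup>2) \<le> (\<Sum>\<^sub>\<infinity>n. w n * (cmod (div_op v n))\<^sup>2)"
  proof (rule weighted_hardy_inequality[where a = "int l - int k"])
    show "finite {n. v n \<noteq> 0}"
      unfolding v_def using u by (intro finite_support_div_op_power) (simp add: H0_space_def)
    show "v n = 0" if "n < int l - int k" for n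
      unfolding v_def using u that by (intro div_op_power_vanishes[of "int l"]) (auto simp: H0_space_def H_space_def)
    show "h n = 0" if "n < int l - int k" for n
      unfolding h_def using g that by (subst div_op_power_vanishes[of "int l"]) (auto simp: H_space_def)
    show "h n > 0" if "n \<ge> int l - int k" for n
      unfolding h_def using A1[OF k that] by (simp add: less_complex_def)
    show "w n \<ge> 0" if "n \<ge> int l - int k" for n
    proof (cases "Suc k = l")
      case False
      then have "Suc k < l" using k by simp
      then have "Re ((div_op ^^ Suc k) g n) > 0"
        and "Re ((neg_laplacian ^^ (l - Suc k)) ((div_op ^^ Suc k) g) n) \<ge> 0"
        using that A1[of "Suc k" n] A2[of "Suc k" n]
        by (auto simp: less_complex_def less_eq_complex_def simp del: funpow.simps)
      then show ?thesis
        using False by (simp add: w_def chain_weight_def del: funpow.simps)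
    qed (simp add: w_def chain_weight_def)
    show "P n = w n * (h (n + 1) - h n)" if "n \<ge> int l - int k - 1" for n
    proof (cases "Suc k = l")
      case True
      then show ?thesis
        unfolding h_Suc by (simp add: w_def chain_weight_def P_def)
    next
      case False
      then have "Re ((div_op ^^ Suc k) g n) > 0"
        using that k A1[of "Suc k" n] by (auto simp: less_complex_def simp del: funpow.simps)
      then show ?thesis
        unfolding h_Suc using False by (simp add: w_def chain_weight_def P_def del: funpow.simps)
    qed
  qed
  then show ?thesis
    by (simp add: chain_energy_def weight w_def v_def)
qed

lemma chain_energy_top:
  assumes "u \<in> H0_space l"
  shows "chain_energy l g u l =
    (\<Sum>\<^sub>\<infinity>n\<in>{\<lceil>real l / 2\<rceil>..}. (cmod (neg_laplacian_half_power l u n))\<^sup>2)"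
proof -
  let ?c = "\<lceil>real l / 2\<rceil>"
  have "(\<Sum>\<^sub>\<infinity>n\<in>{?c..}. (cmod (neg_laplacian_half_power l u n))\<^sup>2)
      = (\<Sum>\<^sub>\<infinity>n. (cmod ((div_op ^^ l) u (n + - ?c)))\<^sup>2)"
    using assms
    by (intro infsum_cong_neutral)
      (auto simp: cmod_neg_laplacian_half_power H0_space_def H_space_def
        intro!: div_op_power_vanishes[of "int l"])
  also have "\<dots> = (\<Sum>\<^sub>\<infinity>n. (cmod ((div_op ^^ l) u n))\<^sup>2)"
    by (rule infsum_translate)
  finally show ?thesis
    by (simp add: chain_energy_def chain_weight_def)
qed

lemma H_space_real_values:
  assumes "g \<in> H_space l" and "\<And>n. n \<ge> int l \<Longrightarrow> g n > 0"
  shows "g n \<in> \<real>"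
proof (cases "n \<ge> int l")
  case True
  then show ?thesis using assms(2)[OF True] by (simp add: less_complex_def complex_is_Real_iff)
next
  case False
  then show ?thesis using assms(1) by (simp add: H_space_def)
qed

lemma rho_eq_chain_weight:
  assumes "\<And>n. g n \<in> \<real>" and "l \<ge> 1"
  shows "rho l g n = complex_of_real (chain_weight l g 0 n)"
proof -
  have "(neg_laplacian ^^ l) g n \<in> \<real>"
    using assms(1) by (rule neg_laplacian_power_real)
  then show ?thesis
    using assms by (simp add: rho_def chain_weight_def of_real_Re)
qed

lemma chain_energy_0:
  assumes "\<And>n. g n \<in> \<real>" and "l \<ge> 1" and "u \<in> H0_space l"
  shows "complex_of_real (chain_energy l g u 0) =
    (\<Sum>\<^sub>\<infinity>n\<in>{int l..}. rho l g n * complex_of_real ((cmod (u n))\<^sup>2))"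
proof -
  have "chain_energy l g u 0 = (\<Sum>\<^sub>\<infinity>n\<in>{int l..}. chain_weight l g 0 n * (cmod (u n))\<^sup>2)"
    unfolding chain_energy_def using assms(3)
    by (intro infsum_cong_neutral) (auto simp: H0_space_def H_space_def not_le)
  also have "complex_of_real \<dots> = (\<Sum>\<^sub>\<infinity>n\<in>{int l..}. complex_of_real (chain_weight l g 0 n * (cmod (u n))\<^sup>2))"
  proof (intro infsumI[symmetric] has_sum_of_real has_sum_infsum finite_nonzero_values_imp_summable_on)
    show "finite {n \<in> {int l..}. chain_weight l g 0 n * (cmod (u n))\<^sup>2 \<noteq> 0}"
      using assms(3) by (auto simp: H0_space_def elim: rev_finite_subset)
  qed
  finally show ?thesis
    by (simp add: rho_eq_chain_weight[OF assms(1,2)])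
qed

theorem theorem2:
  fixes l :: nat and g :: "int \<Rightarrow> complex"
  assumes "l \<ge> 1"
    and "g \<in> H_space l"
    and A1: "\<And>(k::nat) (n::int). k < l \<Longrightarrow> n \<ge> int l - int k \<Longrightarrow> (div_op ^^ k) g n > 0"
    and A2: "\<And>(k::nat) (n::int). 1 \<le> k \<Longrightarrow> k < l \<Longrightarrow> n \<ge> int l + 1 - int k \<Longrightarrow>
               (neg_laplacian ^^ (l - k)) ((div_op ^^ k) g) n \<ge> 0"
  shows "(\<forall>u \<in> H0_space l.
            complex_of_real
              (\<Sum>\<^sub>\<infinity>n\<in>{\<lceil>real l / 2\<rceil>..}. (cmod (neg_laplacian_half_power l u n))\<^sup>2)
            \<ge> (\<Sum>\<^sub>\<infinity>n\<in>{int l..}. rho l g n * complex_of_real ((cmod (u n))\<^sup>2)))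
       \<and> ((\<forall>n \<ge> int l. (neg_laplacian ^^ l) g n \<ge> 0) \<longrightarrow>
            (\<forall>n \<ge> int l. rho l g n \<ge> 0) \<and> HRB_weight l (rho l g))"
proof -
  have g_pos: "g n > 0" if "n \<ge> int l" for n
    using A1[of 0 n] that \<open>l \<ge> 1\<close> by simp
  have g_real: "g n \<in> \<real>" for n
    using H_space_real_values[OF \<open>g \<in> H_space l\<close> g_pos] .
  have ineq: "HRB_inequality l (rho l g) u" if u: "u \<in> H0_space l" for u
  proof -
    have "chain_energy l g u 0 \<le> chain_energy l g u l"
    proof (rule inc_induct[of 0 l "\<lambda>k. chain_energy l g u k \<le> chain_energy l g u l"])
      fix k assume "k < l" "chain_energy l g u (Suc k) \<le> chain_energy l g u l"
      then show "chain_energy l g u k \<le> chain_energy l g u l"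
        using chain_energy_mono_step[OF \<open>g \<in> H_space l\<close> A1 A2 u] order_trans by blast
    qed simp_all
    then have "complex_of_real (chain_energy l g u 0) \<le> complex_of_real (chain_energy l g u l)"
      by (simp add: less_eq_complex_def)
    then show ?thesis
      unfolding HRB_inequality_def chain_energy_0[OF g_real \<open>l \<ge> 1\<close> u] chain_energy_top[OF u] .
  qed
  have rho_nonneg: "rho l g n \<ge> 0"
    if "\<forall>n \<ge> int l. (neg_laplacian ^^ l) g n \<ge> 0" "n \<ge> int l" for n
    using that g_pos[of n] \<open>l \<ge> 1\<close> unfolding rho_eq_chain_weight[OF g_real \<open>l \<ge> 1\<close>]
    by (auto simp: chain_weight_def less_eq_complex_def less_complex_def)
  show ?thesis
    using ineq rho_nonneg unfolding HRB_weight_def HRB_inequality_def by blast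
qed

end
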